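(* Let $K,L\leq \mathrm{Aut}(Q_n)$ with $d_K\geq 5$. Then $(Q_n)_K$ and $(Q_n)_L$ are isomorphic if and only if $K$ and $L$ are conjugate in $\mathrm{Aut}(Q_n)$. In particular, $\mathrm{Aut}((Q_n)_K)=N_{\mathrm{Aut}(Q_n)}(K)/K$, where $N_{\mathrm{Aut}(Q_n)}(K)$ acts on the vertices of $(Q_n)_K$ by $(x^K)^g:=(x^g)^K$.
   Context: The $n$-cube $Q_n$ has vertex set $\mathbb{F}_2^n$, two vectors adjacent iff their Hamming distance is $1$; $\mathrm{Aut}(Q_n)=\mathbb{F}_2^n: S_n$ (translations and coordinate permutations), acting on the right. For $K\leq\mathrm{Aut}(Q_n)$, $d_K:=\min\{d_{Q_n}(x,x^k): x\in\mathbb{F}_2^n,\ 1\neq k\in K\}$ if $K\neq 1$ and $d_K:=\infty$ if $K=1$. The normal quotient $(Q_n)_K$ is the simple graph whose vertices are the $K$-orbits $x^K$ on $\mathbb{F}_2^n$, distinct orbits adjacent iff some vertex of one is adjacent in $Q_n$ to some vertex of the other. *)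

theory Defs
  imports "HOL-Algebra.Group_Action" "HOL-Library.Z2" "HOL-Library.Extended_Nat"
begin

section \<open>Simple graphs, isomorphisms and automorphism groups\<close>

record 'a graph_rec =
  verts :: "'a set"
  adj :: "'a \<Rightarrow> 'a \<Rightarrow> bool"

definition simple_graph :: "'a graph_rec \<Rightarrow> bool" where
  "simple_graph G \<longleftrightarrow>
     (\<forall>x y. adj G x y \<longrightarrow> x \<in> verts G \<and> y \<in> verts G \<and> x \<noteq> y \<and> adj G y x)"

definition is_graph_iso :: "'a graph_rec \<Rightarrow> 'b graph_rec \<Rightarrow> ('a \<Rightarrow> 'b) \<Rightarrow> bool" where
  "is_graph_iso G H f \<longleftrightarrow>
     bij_betw f (verts G) (verts H) \<and>
     (\<forall>x\<in>verts G. \<forall>y\<in>verts G. adj G x y \<longleftrightarrow> adj H (f x) (f y))"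

definition graph_isomorphic :: "'a graph_rec \<Rightarrow> 'b graph_rec \<Rightarrow> bool" where
  "graph_isomorphic G H \<longleftrightarrow> (\<exists>f. is_graph_iso G H f)"

text \<open>
  Groups act on the right: the product \<open>f \<otimes> g\<close> is \<open>f\<close> followed by \<open>g\<close>, so that
  \<open>x\<^sup>g\<close> is the application \<open>g x\<close>. (This is the opposite of the convention of \<open>BijGroup\<close>.)
  As in \<open>Bij\<close>, automorphisms are extensional, so that they are determined by their values
  on the vertices.
\<close>

definition Aut :: "'a graph_rec \<Rightarrow> ('a \<Rightarrow> 'a) monoid" where
  "Aut G =
     \<lparr>carrier = {f \<in> Bij (verts G). is_graph_iso G G f},
      mult = (\<lambda>f g. compose (verts G) g f),
      one = (\<lambda>x\<in>verts G. x)\<rparr>"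

text \<open>The length of a shortest walk; \<open>\<infinity>\<close> if there is none.\<close>

definition graph_dist :: "'a graph_rec \<Rightarrow> 'a \<Rightarrow> 'a \<Rightarrow> enat" where
  "graph_dist G x y = (INF m\<in>{m. (adj G ^^ m) x y}. enat m)"


section \<open>The cube and its normal quotients\<close>

definition hamming_dist :: "nat \<Rightarrow> (nat \<Rightarrow> bit) \<Rightarrow> (nat \<Rightarrow> bit) \<Rightarrow> nat" where
  "hamming_dist n x y = card {i. i < n \<and> x i \<noteq> y i}"

definition cube :: "nat \<Rightarrow> (nat \<Rightarrow> bit) graph_rec" where
  "cube n =
     \<lparr>verts = {..<n} \<rightarrow>\<^sub>E (UNIV :: bit set),
      adj = (\<lambda>x y. x \<in> {..<n} \<rightarrow>\<^sub>E UNIV \<and> y \<in> {..<n} \<rightarrow>\<^sub>E UNIV \<and> hamming_dist n x y = 1)\<rparr>"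

text \<open>
  The infimum in \<^typ>\<open>enat\<close> is the minimum of a nonempty set, and is \<open>\<infinity>\<close> for the empty set,
  which occurs exactly when \<open>K\<close> is trivial.
\<close>

definition min_displacement :: "'a graph_rec \<Rightarrow> ('a \<Rightarrow> 'a) set \<Rightarrow> enat" where
  "min_displacement G K =
     Inf {graph_dist G x (k x) | x k. x \<in> verts G \<and> k \<in> K \<and> k \<noteq> \<one>\<^bsub>Aut G\<^esub>}"

definition orbit_of :: "('a \<Rightarrow> 'a) set \<Rightarrow> 'a \<Rightarrow> 'a set" where
  "orbit_of K x = {k x | k. k \<in> K}"

definition normal_quotient :: "'a graph_rec \<Rightarrow> ('a \<Rightarrow> 'a) set \<Rightarrow> 'a set graph_rec" where
  "normal_quotient G K =
     \<lparr>verts = orbit_of K ` verts G,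
      adj = (\<lambda>X Y. X \<in> orbit_of K ` verts G \<and> Y \<in> orbit_of K ` verts G \<and> X \<noteq> Y \<and>
                   (\<exists>x\<in>X. \<exists>y\<in>Y. adj G x y))\<rparr>"

definition conjugate_in :: "('g, 'm) monoid_scheme \<Rightarrow> 'g set \<Rightarrow> 'g set \<Rightarrow> bool" where
  "conjugate_in G H H' \<longleftrightarrow> (\<exists>g\<in>carrier G. H' = inv\<^bsub>G\<^esub> g <#\<^bsub>G\<^esub> (H #>\<^bsub>G\<^esub> g))"

lemma simple_graph_cube: "simple_graph (cube n)"
proof -
  have sym: "hamming_dist n x y = hamming_dist n y x" for x y
    unfolding hamming_dist_def by (metis (no_types))
  have "x \<noteq> y" if "hamming_dist n x y = 1" for x y
    using that by (auto simp: hamming_dist_def)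
  then show ?thesis
    unfolding simple_graph_def cube_def using sym by simp
qed

lemma simple_graph_normal_quotient:
  assumes "simple_graph G"
  shows "simple_graph (normal_quotient G K)"
proof -
  have "adj G y x" if "adj G x y" for x y
    using assms that unfolding simple_graph_def by blast
  then show ?thesis
    unfolding simple_graph_def normal_quotient_def graph_rec.simps by blast
qed

lemma mem_carrier_Aut:
  "f \<in> carrier (Aut G) \<longleftrightarrow>
     f \<in> Bij (verts G) \<and> (\<forall>x\<in>verts G. \<forall>y\<in>verts G. adj G (f x) (f y) = adj G x y)"
  unfolding Aut_def is_graph_iso_def Bij_def monoid.simps partial_object.simps by blast

lemma group_Aut: "group (Aut G)"
proof (rule groupI)
  fix f g assume fg: "f \<in> carrier (Aut G)" "g \<in> carrier (Aut G)"
  then have "f x \<in> verts G" if "x \<in> verts G" for x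
    using that by (auto simp: mem_carrier_Aut dest!: Bij_imp_funcset)
  moreover have "compose (verts G) g f \<in> Bij (verts G)"
    using fg by (simp add: mem_carrier_Aut compose_Bij)
  ultimately have "compose (verts G) g f \<in> carrier (Aut G)"
    using fg by (simp add: mem_carrier_Aut compose_eq)
  then show "f \<otimes>\<^bsub>Aut G\<^esub> g \<in> carrier (Aut G)"
    by (simp add: Aut_def)
next
  show "\<one>\<^bsub>Aut G\<^esub> \<in> carrier (Aut G)"
    unfolding mem_carrier_Aut by (simp add: Aut_def id_Bij)
next
  fix f g h
  assume "f \<in> carrier (Aut G)" "g \<in> carrier (Aut G)" "h \<in> carrier (Aut G)"
  then have "f \<in> verts G \<rightarrow> verts G"
    by (simp add: mem_carrier_Aut Bij_imp_funcset)
  then show "f \<otimes>\<^bsub>Aut G\<^esub> g \<otimes>\<^bsub>Aut G\<^esub> h = f \<otimes>\<^bsub>Aut G\<^esub> (g \<otimes>\<^bsub>Aut G\<^esub> h)"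
    by (simp add: Aut_def) (metis compose_assoc)
next
  fix f assume "f \<in> carrier (Aut G)"
  then have "f \<in> verts G \<rightarrow> verts G" "f \<in> extensional (verts G)"
    by (simp_all add: mem_carrier_Aut Bij_imp_funcset Bij_imp_extensional)
  then show "\<one>\<^bsub>Aut G\<^esub> \<otimes>\<^bsub>Aut G\<^esub> f = f"
    by (simp add: Aut_def compose_Id)
next
  fix f assume f: "f \<in> carrier (Aut G)"
  let ?V = "verts G"
  let ?i = "\<lambda>x\<in>?V. inv_into ?V f x"
  have B: "f \<in> Bij ?V" and b: "bij_betw f ?V ?V"
    and a: "\<And>x y. x \<in> ?V \<Longrightarrow> y \<in> ?V \<Longrightarrow> adj G (f x) (f y) = adj G x y"
    using f by (auto simp: mem_carrier_Aut Bij_def)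
  have iV: "inv_into ?V f x \<in> ?V" "f (inv_into ?V f x) = x" if "x \<in> ?V" for x
    using b that by (auto simp: bij_betw_def inv_into_into f_inv_into_f)
  have "adj G (inv_into ?V f x) (inv_into ?V f y) = adj G x y" if "x \<in> ?V" "y \<in> ?V" for x y
    using a[OF iV(1)[OF that(1)] iV(1)[OF that(2)]] iV(2) that by simp
  then have "?i \<in> carrier (Aut G)"
    using restrict_inv_into_Bij[OF B] by (simp add: mem_carrier_Aut)
  moreover have "?i \<otimes>\<^bsub>Aut G\<^esub> f = \<one>\<^bsub>Aut G\<^esub>"
    using iV by (simp add: Aut_def compose_def fun_eq_iff)
  ultimately show "\<exists>h\<in>carrier (Aut G). h \<otimes>\<^bsub>Aut G\<^esub> f = \<one>\<^bsub>Aut G\<^esub>" by blast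
qed

end

(*
  A graph map is treated as a covering when it is bijective on the neighbours of each vertex.
  If d_K >= 5, the orbit map p_K of the cube is a covering, and a common neighbour of p_K(u) and
  p_K(w), for u and w with a common neighbour, lifts to a common neighbour of u and w. Given an
  isomorphism phi from the quotient by K to the quotient by L, counting neighbours shows that the
  orbit map p_L is a covering as well. Choose c with p_L(c) = phi(p_K(0)); matching the neighbours of
  0 and c defines a coordinate permutation, hence an automorphism f of the cube with f(0) = c.
  By induction on the weight of x, completing 4-cycles, p_L(f(x)) = phi(p_K(x)) for all x. So the
  conjugate of K by f has the same orbits as L, and by uniqueness of lifts the two groups coincide.
  For L = K this shows that the normalizer of K maps onto the automorphism group of the quotient;
  by uniqueness of lifts again, the kernel is K.
*)
theory Submission
  imports Defs "HOL-Algebra.Zassenhaus"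
begin

section \<open>Automorphisms as maps, orbits and adjacency in normal quotients\<close>

lemma Aut_closed: "f \<in> carrier (Aut G) \<Longrightarrow> x \<in> verts G \<Longrightarrow> f x \<in> verts G"
  by (auto simp: mem_carrier_Aut dest!: Bij_imp_funcset)

lemma Aut_mult_apply: "x \<in> verts G \<Longrightarrow> (f \<otimes>\<^bsub>Aut G\<^esub> g) x = g (f x)"
  by (simp add: Aut_def compose_eq)

lemma Aut_adj:
  "f \<in> carrier (Aut G) \<Longrightarrow> x \<in> verts G \<Longrightarrow> y \<in> verts G \<Longrightarrow> adj G (f x) (f y) \<longleftrightarrow> adj G x y"
  by (simp add: mem_carrier_Aut)

lemma Aut_one_apply: "x \<in> verts G \<Longrightarrow> \<one>\<^bsub>Aut G\<^esub> x = x"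
  by (simp add: Aut_def)

lemma Aut_inv_closed: "f \<in> carrier (Aut G) \<Longrightarrow> inv\<^bsub>Aut G\<^esub> f \<in> carrier (Aut G)"
  by (rule group.inv_closed[OF group_Aut])

lemma Aut_inv_apply:
  assumes "f \<in> carrier (Aut G)" "x \<in> verts G"
  shows "(inv\<^bsub>Aut G\<^esub> f) (f x) = x" "f ((inv\<^bsub>Aut G\<^esub> f) x) = x"
proof -
  interpret group "Aut G" by (rule group_Aut)
  have i: "inv\<^bsub>Aut G\<^esub> f \<in> carrier (Aut G)" using assms by simp
  show "(inv\<^bsub>Aut G\<^esub> f) (f x) = x"
    using Aut_mult_apply[OF assms(2), of f "inv\<^bsub>Aut G\<^esub> f"] assms by (simp add: Aut_one_apply)
  show "f ((inv\<^bsub>Aut G\<^esub> f) x) = x"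
    using Aut_mult_apply[OF assms(2), of "inv\<^bsub>Aut G\<^esub> f" f] assms by (simp add: Aut_one_apply)
qed

lemma Aut_eqI:
  assumes "f \<in> carrier (Aut G)" "g \<in> carrier (Aut G)"
    and "\<And>x. x \<in> verts G \<Longrightarrow> f x = g x"
  shows "f = g"
  using assms by (auto simp: mem_carrier_Aut intro: extensionalityI dest!: Bij_imp_extensional)

lemma Aut_image:
  assumes "f \<in> carrier (Aut G)" shows "f ` verts G = verts G"
  using assms by (auto simp: mem_carrier_Aut Bij_def bij_betw_def)

lemma orbit_of_mem_iff: "y \<in> orbit_of K x \<longleftrightarrow> (\<exists>k\<in>K. y = k x)"
  by (auto simp: orbit_of_def)

context
  fixes G :: "'a graph_rec" and K :: "('a \<Rightarrow> 'a) set"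
  assumes K: "subgroup K (Aut G)"
begin

lemma subgroup_Aut_mem: "k \<in> K \<Longrightarrow> k \<in> carrier (Aut G)"
  using subgroup.mem_carrier[OF K] .

lemma orbit_of_refl: "x \<in> verts G \<Longrightarrow> x \<in> orbit_of K x"
  using subgroup.one_closed[OF K] unfolding orbit_of_mem_iff by (metis Aut_one_apply)

lemma orbit_of_subset: "x \<in> verts G \<Longrightarrow> orbit_of K x \<subseteq> verts G"
  by (auto simp: orbit_of_mem_iff intro: Aut_closed[OF subgroup_Aut_mem])

lemma orbit_of_sym:
  assumes "x \<in> verts G" "y \<in> orbit_of K x" shows "x \<in> orbit_of K y"
proof -
  obtain k where k: "k \<in> K" "y = k x" using assms by (auto simp: orbit_of_mem_iff)
  then show ?thesis
    using subgroup.m_inv_closed[OF K k(1)] Aut_inv_apply(1)[OF subgroup_Aut_mem[OF k(1)] assms(1)]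
    unfolding orbit_of_mem_iff by metis
qed

lemma orbit_of_trans:
  assumes "x \<in> verts G" "y \<in> orbit_of K x" "z \<in> orbit_of K y" shows "z \<in> orbit_of K x"
proof -
  obtain k l where k: "k \<in> K" "y = k x" "l \<in> K" "z = l y"
    using assms by (auto simp: orbit_of_mem_iff)
  then have "k \<otimes>\<^bsub>Aut G\<^esub> l \<in> K" "(k \<otimes>\<^bsub>Aut G\<^esub> l) x = z"
    using subgroup.m_closed[OF K] Aut_mult_apply[OF assms(1)] subgroup_Aut_mem by auto
  then show ?thesis by (auto simp: orbit_of_mem_iff)
qed

lemma orbit_of_eq_iff:
  assumes "x \<in> verts G" "y \<in> verts G"
  shows "orbit_of K x = orbit_of K y \<longleftrightarrow> y \<in> orbit_of K x"
proof
  assume "y \<in> orbit_of K x"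
  then show "orbit_of K x = orbit_of K y"
    using orbit_of_trans[of x y] orbit_of_trans[of y x] orbit_of_sym[of x y] assms by blast
qed (use orbit_of_refl[of y] assms in auto)

lemma orbit_of_apply:
  assumes "x \<in> verts G" "k \<in> K" shows "orbit_of K (k x) = orbit_of K x"
  using assms orbit_of_eq_iff[of x "k x"] Aut_closed subgroup_Aut_mem
  by (metis orbit_of_mem_iff)

text \<open>An element of \<open>K\<close> taking the endpoint \<open>u\<close> back to
  \<open>x\<close> carries the edge from \<open>u\<close> to \<open>v\<close> to an edge at
  \<open>x\<close>, so all neighbours of an orbit are visible from any one of its vertices. Edges
  inside the orbit are excluded, since they vanish in the quotient.\<close>

lemma normal_quotient_adj_iff:
  assumes "x \<in> verts G" "simple_graph G"
  shows "adj (normal_quotient G K) (orbit_of K x) Y \<longleftrightarrow>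
    (\<exists>y. adj G x y \<and> y \<notin> orbit_of K x \<and> Y = orbit_of K y)"
proof
  assume L: "adj (normal_quotient G K) (orbit_of K x) Y"
  then obtain u v z where uv: "u \<in> orbit_of K x" "v \<in> Y" "adj G u v" "z \<in> verts G"
      "Y = orbit_of K z" "orbit_of K x \<noteq> Y"
    by (auto simp: normal_quotient_def)
  have V: "u \<in> verts G" "v \<in> verts G"
    using uv(3) assms(2) by (auto simp: simple_graph_def)
  obtain k where k: "k \<in> K" "x = k u"
    using orbit_of_sym[OF assms(1) uv(1)] by (auto simp: orbit_of_mem_iff)
  have "adj G x (k v)"
    using uv(3) Aut_adj[OF subgroup_Aut_mem[OF k(1)] V(1) V(2)] k
      subgroup_Aut_mem by auto
  moreover have "orbit_of K (k v) = Y"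
    using orbit_of_apply[OF V(2) k(1)] orbit_of_eq_iff[OF uv(4) V(2)] uv by auto
  moreover have "k v \<notin> orbit_of K x"
    using calculation uv(6) orbit_of_eq_iff[OF assms(1), of "k v"] V(2) k(1)
      Aut_closed subgroup_Aut_mem by metis
  ultimately show "\<exists>y. adj G x y \<and> y \<notin> orbit_of K x \<and> Y = orbit_of K y" by blast
next
  assume "\<exists>y. adj G x y \<and> y \<notin> orbit_of K x \<and> Y = orbit_of K y"
  then obtain y where y: "adj G x y" "y \<notin> orbit_of K x" "Y = orbit_of K y" by blast
  then have "y \<in> verts G" using assms(2) by (auto simp: simple_graph_def)
  then show "adj (normal_quotient G K) (orbit_of K x) Y"
    using y assms(1) orbit_of_refl orbit_of_eq_iff[OF assms(1), of y]
    by (auto simp: normal_quotient_def)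
qed

end

section \<open>Displacement and coverings of graphs\<close>

lemma min_displacement_walk:
  assumes "min_displacement G K \<ge> 5" "x \<in> verts G" "k \<in> K" "m \<le> 4" "(adj G ^^ m) x (k x)"
  shows "k = \<one>\<^bsub>Aut G\<^esub>"
proof (rule ccontr)
  assume "k \<noteq> \<one>\<^bsub>Aut G\<^esub>"
  \<comment> \<open>A nontrivial \<open>k\<close> contributes its displacement of \<open>x\<close>
    to the infimum, and a walk of length \<open>m\<close> bounds that displacement by
    \<open>m\<close>.\<close>
  then have "min_displacement G K \<le> graph_dist G x (k x)"
    unfolding min_displacement_def using assms by (intro Inf_lower) blast
  also have "\<dots> \<le> enat m"
    unfolding graph_dist_def using assms(5) by (intro INF_lower) simp
  also have "\<dots> \<le> enat 4" using assms(4) by simp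
  finally have "(5::enat) \<le> enat 4" using assms(1) order_trans by blast
  then show False by (simp add: numeral_eq_enat)
qed

definition graph_cover :: "'a graph_rec \<Rightarrow> 'b graph_rec \<Rightarrow> ('a \<Rightarrow> 'b) \<Rightarrow> bool" where
  "graph_cover G H q \<longleftrightarrow> q ` verts G = verts H \<and>
     (\<forall>x\<in>verts G. bij_betw q {y. adj G x y} {Y. adj H (q x) Y})"

lemma graph_cover_iso:
  assumes c: "graph_cover G H p" and i: "is_graph_iso H H' \<phi>"
    and s: "simple_graph H" "simple_graph H'"
  shows "graph_cover G H' (\<phi> \<circ> p)"
proof -
  have "bij_betw \<phi> {Y. adj H X Y} {Y. adj H' (\<phi> X) Y}" if X: "X \<in> verts H" for X
  proof (rule bij_betw_subset)
    show "bij_betw \<phi> (verts H) (verts H')" using i by (simp add: is_graph_iso_def)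
    show "{Y. adj H X Y} \<subseteq> verts H" using s by (auto simp: simple_graph_def)
    show "\<phi> ` {Y. adj H X Y} = {Y. adj H' (\<phi> X) Y}"
    proof -
      have "\<exists>Z. adj H X Z \<and> Y = \<phi> Z" if "adj H' (\<phi> X) Y" for Y
      proof -
        have "Y \<in> verts H'" using that s by (auto simp: simple_graph_def)
        then obtain Z where "Z \<in> verts H" "Y = \<phi> Z"
          using i unfolding is_graph_iso_def bij_betw_def by blast
        then show ?thesis using that i X unfolding is_graph_iso_def by blast
      qed
      moreover have "adj H' (\<phi> X) (\<phi> Z)" if "adj H X Z" for Z
        using that i s(1) X unfolding is_graph_iso_def simple_graph_def by blast
      ultimately show ?thesis by auto
    qed
  qed
  moreover have "p x \<in> verts H" if "x \<in> verts G" for x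
    using c that by (auto simp: graph_cover_def)
  ultimately have "bij_betw (\<phi> \<circ> p) {y. adj G x y} {Y. adj H' ((\<phi> \<circ> p) x) Y}"
    if "x \<in> verts G" for x
    using c that bij_betw_trans unfolding graph_cover_def comp_apply by metis
  moreover have "(\<phi> \<circ> p) ` verts G = verts H'"
    using c i unfolding graph_cover_def is_graph_iso_def bij_betw_def image_comp[symmetric] by simp
  ultimately show ?thesis by (simp add: graph_cover_def)
qed

lemma graph_coverD:
  assumes "graph_cover G H q" "x \<in> verts G"
  shows graph_cover_adj: "adj G x y \<Longrightarrow> adj H (q x) (q y)"
    and graph_cover_inj: "adj G x y \<Longrightarrow> adj G x z \<Longrightarrow> q y = q z \<Longrightarrow> y = z"
    and graph_cover_lift: "adj H (q x) Y \<Longrightarrow> \<exists>y. adj G x y \<and> q y = Y"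
proof -
  have b: "bij_betw q {y. adj G x y} {Y. adj H (q x) Y}"
    using assms by (simp add: graph_cover_def)
  then have im: "q ` {y. adj G x y} = {Y. adj H (q x) Y}" and inj: "inj_on q {y. adj G x y}"
    by (auto simp: bij_betw_def)
  show "adj G x y \<Longrightarrow> adj H (q x) (q y)" using im by blast
  show "\<exists>y. adj G x y \<and> q y = Y" if "adj H (q x) Y"
  proof -
    have "Y \<in> q ` {y. adj G x y}" using im that by simp
    then show ?thesis by blast
  qed
  show "adj G x y \<Longrightarrow> adj G x z \<Longrightarrow> q y = q z \<Longrightarrow> y = z"
    using inj by (simp add: inj_on_def)
qed

lemma graph_coverI:
  assumes "q ` verts G = verts H"
    and "\<And>x y. adj G x y \<Longrightarrow> adj H (q x) (q y)"
    and "\<And>x y z. adj G x y \<Longrightarrow> adj G x z \<Longrightarrow> q y = q z \<Longrightarrow> y = z"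
    and "\<And>x Y. x \<in> verts G \<Longrightarrow> adj H (q x) Y \<Longrightarrow> \<exists>y. adj G x y \<and> q y = Y"
  shows "graph_cover G H q"
  unfolding graph_cover_def bij_betw_def
proof (intro conjI ballI)
  fix x assume x: "x \<in> verts G"
  show "inj_on q {y. adj G x y}" using assms(3) by (simp add: inj_on_def)
  show "q ` {y. adj G x y} = {Y. adj H (q x) Y}"
    using assms(2) assms(4)[OF x] by blast
qed (rule assms(1))

lemma graph_cover_cong:
  assumes "graph_cover G H q" "\<And>x. x \<in> verts G \<Longrightarrow> q x = q' x" "simple_graph G"
  shows "graph_cover G H q'"
proof -
  have v: "adj G x y \<Longrightarrow> x \<in> verts G \<and> y \<in> verts G" for x y
    using assms(3) by (simp add: simple_graph_def)
  show ?thesis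
    using assms(1) assms(2) v unfolding graph_cover_def
    by (auto simp: bij_betw_def inj_on_def image_def)
qed

section \<open>Uniqueness of lifts; groups determined by their orbits\<close>

text \<open>Unique path lifting: where \<open>f\<close> and \<open>g\<close> agree at one vertex of
  a walk, their values at the next vertex are neighbours of a common vertex with equal images under
  \<open>q\<close>, and local injectivity of \<open>q\<close> identifies them.\<close>

lemma graph_cover_rigid:
  assumes s: "simple_graph G" and c: "graph_cover G H q"
    and f: "f \<in> carrier (Aut G)" and g: "g \<in> carrier (Aut G)"
    and eq: "\<And>x. x \<in> verts G \<Longrightarrow> q (f x) = q (g x)"
    and x: "x \<in> verts G" "f x = g x" and con: "(adj G)\<^sup>*\<^sup>* x y"
  shows "f y = g y"
  using con
proof induction
  case base then show ?case by (rule x(2))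
next
  case (step y z)
  have v: "y \<in> verts G" "z \<in> verts G"
    using step.hyps(2) s by (auto simp: simple_graph_def)
  have "adj G (f y) (f z)" "adj G (f y) (g z)"
    using step Aut_adj[OF f v] Aut_adj[OF g v] by auto
  then show ?case
    using graph_cover_inj[OF c Aut_closed[OF f v(1)]] eq[OF v(2)] by blast
qed

text \<open>At the base vertex \<open>x\<close>, a given \<open>m\<close> acts like some
  \<open>l\<close> in \<open>L\<close>. As both move every vertex within its \<open>L\<close>-orbit,
  they have the same composite with the orbit map, and rigidity yields \<open>m = l\<close>.
  \<open>M\<close> is a mere set of automorphisms, so that the criterion can also be applied to a
  single one.\<close>

lemma subset_if_orbits_subset:
  assumes s: "simple_graph G" and con: "\<And>y. y \<in> verts G \<Longrightarrow> (adj G)\<^sup>*\<^sup>* x y" and x: "x \<in> verts G"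
    and M: "M \<subseteq> carrier (Aut G)" and L: "subgroup L (Aut G)"
    and c: "graph_cover G H (orbit_of L)"
    and sub: "\<And>y. y \<in> verts G \<Longrightarrow> orbit_of M y \<subseteq> orbit_of L y"
  shows "M \<subseteq> L"
proof
  fix m assume m: "m \<in> M"
  then have "m x \<in> orbit_of M x" unfolding orbit_of_mem_iff by blast
  then have "m x \<in> orbit_of L x" using sub[OF x] by blast
  then obtain l where l: "l \<in> L" "m x = l x" by (auto simp: orbit_of_mem_iff)
  have mc: "m \<in> carrier (Aut G)" and lc: "l \<in> carrier (Aut G)"
    using m l subgroup_Aut_mem[OF L] M by auto
  have "orbit_of L (m y) = orbit_of L (l y)" if y: "y \<in> verts G" for y
  proof -
    have "m y \<in> orbit_of M y" using m unfolding orbit_of_mem_iff by blast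
    then have "m y \<in> orbit_of L y" using sub[OF y] by blast
    then show ?thesis
      using orbit_of_eq_iff[OF L y Aut_closed[OF mc y]] orbit_of_apply[OF L y l(1)] by simp
  qed
  then have "m = l"
    using graph_cover_rigid[OF s c mc lc _ x l(2) con] Aut_eqI[OF mc lc] by blast
  then show "m \<in> L" using l by simp
qed

lemma eq_if_orbits_eq:
  assumes s: "simple_graph G" and con: "\<And>y. y \<in> verts G \<Longrightarrow> (adj G)\<^sup>*\<^sup>* x y" and x: "x \<in> verts G"
    and M: "subgroup M (Aut G)" and L: "subgroup L (Aut G)"
    and c: "graph_cover G H (orbit_of L)"
    and eq: "\<And>y. y \<in> verts G \<Longrightarrow> orbit_of M y = orbit_of L y"
  shows "M = L"
proof
  show "M \<subseteq> L"
    using subset_if_orbits_subset[OF s con x subgroup.subset[OF M] L c] eq by blast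
  \<comment> \<open>The two orbit maps agree on vertices, so the covering passes to \<open>M\<close>
    and the inclusion criterion applies with the roles exchanged.\<close>
  have "graph_cover G H (orbit_of M)"
    using graph_cover_cong[OF c eq[symmetric] s] .
  then show "L \<subseteq> M"
    using subset_if_orbits_subset[OF s con x subgroup.subset[OF L] M] eq by blast
qed

section \<open>Orbit maps as coverings\<close>

lemma relpowp_2: "P x y \<Longrightarrow> P y z \<Longrightarrow> (P ^^ Suc (Suc 0)) x z"
  by (blast intro: relpowp_0_I relpowp_Suc_I)

lemma relpowp_4:
  "P x y \<Longrightarrow> P y z \<Longrightarrow> P z u \<Longrightarrow> P u v \<Longrightarrow> (P ^^ Suc (Suc (Suc (Suc 0)))) x v"
  by (blast intro: relpowp_0_I relpowp_Suc_I)

lemma min_displacement_walk_eq: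
  assumes K: "subgroup K (Aut G)" and d: "min_displacement G K \<ge> 5" and x: "x \<in> verts G"
    and y: "y \<in> orbit_of K x" and m: "m \<le> 4" "(adj G ^^ m) x y"
  shows "y = x"
proof -
  obtain k where k: "k \<in> K" "y = k x" using y by (auto simp: orbit_of_mem_iff)
  then have "k = \<one>\<^bsub>Aut G\<^esub>" using min_displacement_walk[OF d x] m by blast
  then show ?thesis using k x by (simp add: Aut_one_apply)
qed

text \<open>A neighbour of \<open>x\<close> in its own orbit would give a displacement of 1, and two
  neighbours of \<open>x\<close> in one orbit are joined by a walk of length 2. Excluding both keeps
  edges alive and neighbours apart; lifting of edges holds in any normal quotient.\<close>

lemma min_displacement_cover:
  assumes K: "subgroup K (Aut G)" and d: "min_displacement G K \<ge> 5" and s: "simple_graph G"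
  shows "graph_cover G (normal_quotient G K) (orbit_of K)"
proof (rule graph_coverI)
  have v: "adj G x y \<Longrightarrow> x \<in> verts G \<and> y \<in> verts G \<and> adj G y x \<and> x \<noteq> y" for x y
    using s unfolding simple_graph_def by blast
  show "orbit_of K ` verts G = verts (normal_quotient G K)"
    by (simp add: normal_quotient_def)
  show "\<exists>y. adj G x y \<and> orbit_of K y = Y"
    if "x \<in> verts G" "adj (normal_quotient G K) (orbit_of K x) Y" for x Y
    using that(2) unfolding normal_quotient_adj_iff[OF K that(1) s] by blast
  show "adj (normal_quotient G K) (orbit_of K x) (orbit_of K y)" if a: "adj G x y" for x y
  proof -
    have "y \<notin> orbit_of K x"
    proof
      assume "y \<in> orbit_of K x"
      moreover have "(adj G ^^ 1) x y" using a by (simp add: OO_def)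
      ultimately have "y = x" using min_displacement_walk_eq[OF K d, of x y 1] v[OF a] by simp
      then show False using v[OF a] by simp
    qed
    then show ?thesis using normal_quotient_adj_iff[OF K _ s] v[OF a] a by blast
  qed
  show "y = z" if a: "adj G x y" "adj G x z" "orbit_of K y = orbit_of K z" for x y z
  proof -
    have "z \<in> orbit_of K y" using a(3) orbit_of_refl[OF K] v[OF a(2)] by blast
    moreover have "adj G y x" using v[OF a(1)] by blast
    then have "(adj G ^^ Suc (Suc 0)) y z"
      using a(2) by (rule relpowp_2)
    moreover have "y \<in> verts G" using v[OF a(1)] by blast
    ultimately show "y = z" 
      by (intro min_displacement_walk_eq[OF K d, of y z "Suc (Suc 0)", symmetric]) simp_all
  qed
qed

lemma common_neighbour_lift:
  assumes K: "subgroup K (Aut G)" and d: "min_displacement G K \<ge> 5" and s: "simple_graph G"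
    and a: "adj G z u" "adj G z w"
    and C: "adj (normal_quotient G K) (orbit_of K u) C" "adj (normal_quotient G K) (orbit_of K w) C"
  shows "\<exists>c. adj G u c \<and> adj G w c \<and> orbit_of K c = C"
proof -
  have v: "adj G x y \<Longrightarrow> x \<in> verts G \<and> y \<in> verts G \<and> adj G y x" for x y
    using s unfolding simple_graph_def by blast
  have uw: "u \<in> verts G" "w \<in> verts G" using v[OF a(1)] v[OF a(2)] by blast+
  obtain c c' where c: "adj G u c" "C = orbit_of K c" "adj G w c'" "C = orbit_of K c'"
    using C unfolding normal_quotient_adj_iff[OF K uw(1) s] normal_quotient_adj_iff[OF K uw(2) s] by blast
  have "c' \<in> orbit_of K c" using c orbit_of_refl[OF K] v[OF c(3)] by blast
  \<comment> \<open>The walk \<open>c, u, z, w, c'\<close> of length 4 is where displacement 5 is needed; 3 suffices for a covering.\<close>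
  moreover have "adj G c u" "adj G u z" using v[OF c(1)] v[OF a(1)] by blast+
  then have "(adj G ^^ Suc (Suc (Suc (Suc 0)))) c c'"
    using a(2) c(3) by (rule relpowp_4)
  moreover have "c \<in> verts G" using v[OF c(1)] by blast
  ultimately have "c' = c"
    by (intro min_displacement_walk_eq[OF K d, of c c' "Suc (Suc (Suc (Suc 0)))"]) simp_all
  then show ?thesis using c by blast
qed

text \<open>The neighbours of an orbit are the images of those neighbours of \<open>x\<close> that
  lie outside it. If their number is still the finite degree of \<open>x\<close>, then no neighbour
  lies inside the orbit and no two are identified. This serves for a group without a displacement
  bound.\<close>

lemma regular_quotient_cover:
  assumes L: "subgroup L (Aut G)" and s: "simple_graph G"
    and fin: "\<And>x. x \<in> verts G \<Longrightarrow> finite {y. adj G x y}"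
    and reg: "\<And>x. x \<in> verts G \<Longrightarrow>
      card {Y. adj (normal_quotient G L) (orbit_of L x) Y} = card {y. adj G x y}"
  shows "graph_cover G (normal_quotient G L) (orbit_of L)"
  unfolding graph_cover_def
proof (intro conjI ballI)
  show "orbit_of L ` verts G = verts (normal_quotient G L)"
    by (simp add: normal_quotient_def)
  fix x assume x: "x \<in> verts G"
  let ?N = "{y. adj G x y}" and ?A = "{y. adj G x y} - orbit_of L x"
  have im: "{Y. adj (normal_quotient G L) (orbit_of L x) Y} = orbit_of L ` ?A"
    using normal_quotient_adj_iff[OF L x s] by blast
  then have c: "card ?N \<le> card ?A"
    using reg[OF x] card_image_le[of ?A "orbit_of L"] fin[OF x] by simp
  then have A: "?A = ?N"
    using card_seteq[OF fin[OF x], of ?A] by auto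
  then have "inj_on (orbit_of L) ?N"
    using eq_card_imp_inj_on[OF fin[OF x], of "orbit_of L"] reg[OF x] im by simp
  then show "bij_betw (orbit_of L) ?N {Y. adj (normal_quotient G L) (orbit_of L x) Y}"
    using im A by (simp add: bij_betw_def)
qed

section \<open>Coordinate flips, edges and weights in the cube\<close>

definition flip :: "(nat \<Rightarrow> bit) \<Rightarrow> nat \<Rightarrow> nat \<Rightarrow> bit" where
  "flip x i = x(i := x i + 1)"

lemma bit_neq_iff: "(a::bit) \<noteq> b \<longleftrightarrow> a = b + 1"
  by (cases "a = 0"; cases "b = 0") auto

lemma flip_apply: "flip x i j = (if j = i then x j + 1 else x j)"
  by (simp add: flip_def)

lemma flip_flip: "flip (flip x i) i = x"
  by (rule ext) (auto simp: flip_apply add.assoc)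

lemma flip_commute: "flip (flip x i) j = flip (flip x j) i"
  by (rule ext) (auto simp: flip_apply)

lemma flip_inj: "flip x i = flip x j \<Longrightarrow> i = j"
  by (metis bit_neq_iff flip_apply)

text \<open>If \<open>a \<noteq> i\<close>, the left side differs from \<open>z\<close> in
  coordinate \<open>i\<close>; as \<open>i \<noteq> j\<close>, the right side can do so only by
  \<open>b = i\<close>. Geometrically, two vertices at distance 2 have only the remaining corners of
  their 4-cycle as common neighbours.\<close>

lemma flip_common:
  assumes "i \<noteq> j" "flip (flip z i) a = flip (flip z j) b"
  shows "flip (flip z i) a = z \<or> flip (flip z i) a = flip (flip z i) j"
proof (cases "a = i")
  case True then show ?thesis by (simp add: flip_flip)
next
  case False
  have "b = i"
  proof (rule ccontr)
    assume "b \<noteq> i"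
    then have "z i + 1 = z i"
      using fun_cong[OF assms(2), of i] False assms(1) by (simp add: flip_apply)
    then show False using bit_neq_iff by blast
  qed
  then show ?thesis using assms(2) by (simp add: flip_commute)
qed

lemma verts_cube: "verts (cube n) = {..<n} \<rightarrow>\<^sub>E UNIV"
  by (simp add: cube_def)

lemma finite_verts_cube: "finite (verts (cube n))"
  unfolding verts_cube by (rule finite_PiE) (auto intro: finite_subset[of _ "{0,1}"])

lemma flip_in_cube: "x \<in> verts (cube n) \<Longrightarrow> i < n \<Longrightarrow> flip x i \<in> verts (cube n)"
  by (auto simp: verts_cube PiE_def extensional_def flip_apply)

lemma cube_eqI:
  assumes "x \<in> verts (cube n)" "y \<in> verts (cube n)" "\<And>i. i < n \<Longrightarrow> x i = y i"
  shows "x = y"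
  using assms unfolding verts_cube by (intro PiE_ext) auto

lemma adj_cube_hamming:
  "x \<in> verts (cube n) \<Longrightarrow> y \<in> verts (cube n) \<Longrightarrow> adj (cube n) x y \<longleftrightarrow> hamming_dist n x y = 1"
  by (simp add: cube_def)

lemma adj_cube_iff:
  assumes "x \<in> verts (cube n)"
  shows "adj (cube n) x y \<longleftrightarrow> (\<exists>i<n. y = flip x i)"
proof
  assume a: "adj (cube n) x y"
  then have y: "y \<in> verts (cube n)" and "card {i. i < n \<and> x i \<noteq> y i} = 1"
    by (auto simp: cube_def hamming_dist_def)
  then obtain i where i: "{i. i < n \<and> x i \<noteq> y i} = {i}" using card_1_singletonE by blast
  have diff: "k < n \<and> x k \<noteq> y k \<longleftrightarrow> k = i" for k
  proof -
    have "k \<in> {i. i < n \<and> x i \<noteq> y i} \<longleftrightarrow> k = i" unfolding i by simp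
    then show ?thesis by simp
  qed
  then have "i < n" by blast
  moreover have "y = flip x i"
  proof (rule cube_eqI[OF y flip_in_cube[OF assms \<open>i < n\<close>]])
    fix j assume "j < n"
    show "y j = flip x i j"
    proof (cases "j = i")
      case True
      then have "y j \<noteq> x j" using diff[of j] by auto
      then show ?thesis using True by (simp add: flip_apply bit_neq_iff)
    next
      case False then show ?thesis using diff[of j] \<open>j < n\<close> by (simp add: flip_apply)
    qed
  qed
  ultimately show "\<exists>i<n. y = flip x i" by blast
next
  assume "\<exists>i<n. y = flip x i"
  then obtain i where i: "i < n" "y = flip x i" by blast
  have "x i + 1 \<noteq> x i" using bit_neq_iff by blast
  then have "{j. j < n \<and> x j \<noteq> y j} = {i}" using i by (auto simp: flip_apply)
  then show "adj (cube n) x y"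
    using adj_cube_hamming[OF assms, of y] flip_in_cube[OF assms i(1)] i
    by (simp add: hamming_dist_def)
qed

lemma adj_cube_flip: "x \<in> verts (cube n) \<Longrightarrow> i < n \<Longrightarrow> adj (cube n) x (flip x i)"
  using adj_cube_iff by blast

lemma card_cube_neighbours:
  assumes "x \<in> verts (cube n)" shows "card {y. adj (cube n) x y} = n"
proof -
  have "{y. adj (cube n) x y} = flip x ` {..<n}" using adj_cube_iff[OF assms] by auto
  moreover have "inj_on (flip x) {..<n}" by (auto intro: inj_onI flip_inj)
  ultimately show ?thesis by (simp add: card_image)
qed

lemma finite_cube_neighbours: "finite {y. adj (cube n) x y}"
  by (rule finite_subset[OF _ finite_verts_cube[of n]]) (auto simp: cube_def)

definition cube_zero :: "nat \<Rightarrow> nat \<Rightarrow> bit" where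
  "cube_zero n = (\<lambda>i\<in>{..<n}. 0)"

lemma cube_zero_in: "cube_zero n \<in> verts (cube n)"
  by (auto simp: cube_zero_def verts_cube)

text \<open>The Hamming weight, the measure for inductions that start at the zero vertex.\<close>

definition weight :: "nat \<Rightarrow> (nat \<Rightarrow> bit) \<Rightarrow> nat" where
  "weight n x = card {i. i < n \<and> x i \<noteq> 0}"

lemma weight_flip_less:
  assumes "i < n" "x i \<noteq> 0" shows "weight n (flip x i) < weight n x"
proof -
  have "{j. j < n \<and> flip x i j \<noteq> 0} = {j. j < n \<and> x j \<noteq> 0} - {i}"
    using assms bit_neq_iff[of "x i" 0] by (auto simp: flip_apply)
  then show ?thesis
    unfolding weight_def using assms card_Diff1_less[of "{j. j < n \<and> x j \<noteq> 0}" i] by simp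
qed

lemma cube_cases:
  assumes "x \<in> verts (cube n)"
  obtains "x = cube_zero n" | i where "i < n" "x i \<noteq> 0"
proof (cases "\<exists>i<n. x i \<noteq> 0")
  case False
  then have "x = cube_zero n"
    by (intro cube_eqI[OF assms cube_zero_in]) (auto simp: cube_zero_def)
  then show thesis by (rule that)
qed (use that in blast)

lemma cube_connected:
  "x \<in> verts (cube n) \<Longrightarrow> (adj (cube n))\<^sup>*\<^sup>* (cube_zero n) x"
proof (induction "weight n x" arbitrary: x rule: less_induct)
  case less
  from less.prems show ?case
  proof (cases rule: cube_cases)
    case (2 i)
    have v: "flip x i \<in> verts (cube n)" using flip_in_cube less.prems 2 by blast
    have "adj (cube n) (flip x i) x"
      using adj_cube_flip[OF v 2(1)] by (simp add: flip_flip)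
    moreover have "weight n (flip x i) < weight n x" by (rule weight_flip_less[of i n x, OF 2])
    ultimately show ?thesis using less.hyps[OF _ v] by simp
  qed simp
qed

section \<open>Automorphisms of the cube from translations and coordinate permutations\<close>

text \<open>The entry at position \<open>i\<close> moves to position \<open>\<sigma> i\<close>,
  whence the inverse of \<open>\<sigma>\<close> in the formula; then \<open>c\<close> is added. The
  outer restriction makes the map extensional, as \<open>Aut\<close> demands, and the inner one
  makes its values vertices of the cube.\<close>

definition cube_aut :: "nat \<Rightarrow> (nat \<Rightarrow> bit) \<Rightarrow> (nat \<Rightarrow> nat) \<Rightarrow> (nat \<Rightarrow> bit) \<Rightarrow> nat \<Rightarrow> bit" where
  "cube_aut n c \<sigma> = (\<lambda>x\<in>verts (cube n). \<lambda>j\<in>{..<n}. c j + x (inv_into {..<n} \<sigma> j))"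

context
  fixes n :: nat and c :: "nat \<Rightarrow> bit" and \<sigma> :: "nat \<Rightarrow> nat"
  assumes \<sigma>: "bij_betw \<sigma> {..<n} {..<n}"
begin

lemma cube_aut_apply:
  "x \<in> verts (cube n) \<Longrightarrow> i < n \<Longrightarrow> cube_aut n c \<sigma> x (\<sigma> i) = c (\<sigma> i) + x i"
  using \<sigma> bij_betwE[OF \<sigma>] by (auto simp: cube_aut_def bij_betw_def)

lemma cube_aut_eq_iff:
  "x \<in> verts (cube n) \<Longrightarrow> y \<in> verts (cube n) \<Longrightarrow> i < n \<Longrightarrow>
    cube_aut n c \<sigma> x (\<sigma> i) = cube_aut n c \<sigma> y (\<sigma> i) \<longleftrightarrow> x i = y i"
  by (simp only: cube_aut_apply add_left_cancel)

lemma cube_aut_closed: "x \<in> verts (cube n) \<Longrightarrow> cube_aut n c \<sigma> x \<in> verts (cube n)"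
  by (auto simp: cube_aut_def verts_cube)

lemma cube_index:
  assumes "j < n" obtains i where "i < n" "j = \<sigma> i"
  using assms \<sigma> by (auto simp: bij_betw_def)

text \<open>Adding \<open>c\<close> cancels when two images are compared, so \<open>\<sigma>\<close>
  carries the positions where \<open>x\<close> and \<open>y\<close> differ bijectively onto those
  where their images differ.\<close>

lemma hamming_cube_aut:
  assumes "x \<in> verts (cube n)" "y \<in> verts (cube n)"
  shows "hamming_dist n (cube_aut n c \<sigma> x) (cube_aut n c \<sigma> y) = hamming_dist n x y"
proof -
  have lt: "\<sigma> i < n" if "i < n" for i using \<sigma> that by (auto simp: bij_betw_def)
  have "{j. j < n \<and> cube_aut n c \<sigma> x j \<noteq> cube_aut n c \<sigma> y j} = \<sigma> ` {i. i < n \<and> x i \<noteq> y i}"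
  proof (intro equalityI subsetI)
    fix j assume j: "j \<in> {j. j < n \<and> cube_aut n c \<sigma> x j \<noteq> cube_aut n c \<sigma> y j}"
    then obtain i where "i < n" "j = \<sigma> i" using cube_index by blast
    then show "j \<in> \<sigma> ` {i. i < n \<and> x i \<noteq> y i}" using j assms by (auto simp: cube_aut_eq_iff)
  qed (use assms lt in \<open>auto simp: cube_aut_eq_iff\<close>)
  moreover have "inj_on \<sigma> {i. i < n \<and> x i \<noteq> y i}"
    using \<sigma> by (auto simp: bij_betw_def inj_on_def)
  ultimately show ?thesis by (simp add: hamming_dist_def card_image)
qed

lemma cube_aut_inj:
  assumes "x \<in> verts (cube n)" "y \<in> verts (cube n)" "cube_aut n c \<sigma> x = cube_aut n c \<sigma> y"
  shows "x = y"
  by (rule cube_eqI[OF assms(1,2)]) (metis assms cube_aut_eq_iff)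

lemma cube_aut_in_Aut: "cube_aut n c \<sigma> \<in> carrier (Aut (cube n))"
proof -
  have "inj_on (cube_aut n c \<sigma>) (verts (cube n))" using cube_aut_inj by (auto intro: inj_onI)
  then have "bij_betw (cube_aut n c \<sigma>) (verts (cube n)) (verts (cube n))"
    using endo_inj_surj[OF finite_verts_cube] cube_aut_closed by (simp add: bij_betw_def image_subsetI)
  then show ?thesis
    using hamming_cube_aut cube_aut_closed
    by (auto simp: mem_carrier_Aut Bij_def adj_cube_hamming) (simp add: cube_aut_def)
qed

lemma cube_aut_zero:
  assumes "c \<in> verts (cube n)" shows "cube_aut n c \<sigma> (cube_zero n) = c"
proof (rule cube_eqI[OF cube_aut_closed[OF cube_zero_in] assms])
  fix j assume "j < n"
  then obtain i where "i < n" "j = \<sigma> i" by (rule cube_index)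
  then show "cube_aut n c \<sigma> (cube_zero n) j = c j"
    by (simp add: cube_aut_apply cube_zero_in) (simp add: cube_zero_def)
qed

lemma cube_aut_flip:
  assumes x: "x \<in> verts (cube n)" and i: "i < n"
  shows "cube_aut n c \<sigma> (flip x i) = flip (cube_aut n c \<sigma> x) (\<sigma> i)"
proof (rule cube_eqI)
  have lt: "\<sigma> i < n" using \<sigma> i by (auto simp: bij_betw_def)
  show "cube_aut n c \<sigma> (flip x i) \<in> verts (cube n)" "flip (cube_aut n c \<sigma> x) (\<sigma> i) \<in> verts (cube n)"
    using lt x i by (auto intro: cube_aut_closed flip_in_cube)
  fix j assume "j < n"
  then obtain k where k: "k < n" "j = \<sigma> k" by (rule cube_index)
  have "\<sigma> k = \<sigma> i \<longleftrightarrow> k = i" using \<sigma> k i by (auto simp: bij_betw_def inj_on_def)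
  then show "cube_aut n c \<sigma> (flip x i) j = flip (cube_aut n c \<sigma> x) (\<sigma> i) j"
    using k x i by (simp add: cube_aut_apply flip_apply flip_in_cube add.assoc)
qed

end

section \<open>Lifting one covering of the cube through another\<close>

text \<open>The automorphism \<open>f\<close> is chosen so that \<open>q \<circ> f\<close> and
  \<open>p\<close> agree at the vertices of weight at most 1; \<open>common\<close> then carries the
  agreement from three corners of a 4-cycle to the fourth.\<close>

lemma cube_lift:
  assumes p: "graph_cover (cube n) H p" and q: "graph_cover (cube n) H q"
    and common: "\<And>z u w C. adj (cube n) z u \<Longrightarrow> adj (cube n) z w \<Longrightarrow> adj H (p u) C \<Longrightarrow> adj H (p w) C \<Longrightarrow>
      \<exists>c. adj (cube n) u c \<and> adj (cube n) w c \<and> p c = C"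
  shows "\<exists>f\<in>carrier (Aut (cube n)). \<forall>x\<in>verts (cube n). q (f x) = p x"
proof -
  let ?o = "cube_zero n" and ?V = "verts (cube n)"
  have "p ?o \<in> p ` ?V" using cube_zero_in by (rule imageI)
  then have "p ?o \<in> q ` ?V" using p q unfolding graph_cover_def by simp
  then obtain c where c: "c \<in> ?V" "q c = p ?o" by auto
  \<comment> \<open>Lifting the edge from \<open>p ?o\<close> to \<open>p (flip ?o i)\<close>
    through \<open>q\<close> at \<open>c\<close> yields the direction \<open>j\<close> that becomes
    \<open>\<sigma> i\<close>.\<close>
  have "\<exists>j<n. q (flip c j) = p (flip ?o i)" if "i < n" for i
  proof -
    have "adj H (q c) (p (flip ?o i))"
      using graph_cover_adj[OF p cube_zero_in adj_cube_flip[OF cube_zero_in that]] c by simp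
    then show ?thesis
      using graph_cover_lift[OF q c(1)] unfolding adj_cube_iff[OF c(1)] by blast
  qed
  then obtain \<sigma> where \<sigma>: "\<And>i. i < n \<Longrightarrow> \<sigma> i < n" "\<And>i. i < n \<Longrightarrow> q (flip c (\<sigma> i)) = p (flip ?o i)"
    by metis
  \<comment> \<open>Equal values of \<open>\<sigma>\<close> would give two neighbours of the zero
    vertex with one image under \<open>p\<close>.\<close>
  have "inj_on \<sigma> {..<n}"
  proof (rule inj_onI)
    fix i j assume ij: "i \<in> {..<n}" "j \<in> {..<n}" "\<sigma> i = \<sigma> j"
    then have "p (flip ?o i) = p (flip ?o j)" using \<sigma>(2)[of i] \<sigma>(2)[of j] by simp
    then have "flip ?o i = flip ?o j"
      using graph_cover_inj[OF p cube_zero_in] adj_cube_flip[OF cube_zero_in] ij by blast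
    then show "i = j" by (rule flip_inj)
  qed
  then have b: "bij_betw \<sigma> {..<n} {..<n}"
    using endo_inj_surj[of "{..<n}" \<sigma>] \<sigma>(1) by (auto simp: bij_betw_def)
  define f where "f = cube_aut n c \<sigma>"
  have fV: "f x \<in> ?V" if "x \<in> ?V" for x unfolding f_def using cube_aut_closed[OF b that] .
  have f0: "f ?o = c" unfolding f_def using cube_aut_zero[OF b c(1)] .
  have ff: "f (flip x i) = flip (f x) (\<sigma> i)" if "x \<in> ?V" "i < n" for x i
    unfolding f_def using cube_aut_flip[OF b that] .
  have fadj: "adj H (q (f x)) (q (f (flip x i)))" if "x \<in> ?V" "i < n" for x i
    using graph_cover_adj[OF q fV[OF that(1)] adj_cube_flip[OF fV[OF that(1)] \<sigma>(1)[OF that(2)]]]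
    by (simp add: ff[OF that])
  have "q (f x) = p x" if "x \<in> ?V" for x
    using that
  proof (induction "weight n x" arbitrary: x rule: less_induct)
    case less
    note x = less.prems
    from x show ?case
    proof (cases rule: cube_cases)
      case 1 then show ?thesis using f0 c by simp
    next
      case (2 i)
      define w where "w = flip x i"
      have wV: "w \<in> ?V" unfolding w_def using flip_in_cube[OF x 2(1)] .
      have xw: "x = flip w i" by (simp add: w_def flip_flip)
      have wx: "weight n w < weight n x" unfolding w_def by (rule weight_flip_less[of i n x, OF 2])
      from wV show ?thesis
      proof (cases rule: cube_cases)
        \<comment> \<open>Here \<open>x\<close> is a neighbour of the zero vertex, and the agreement
          is the choice of \<open>\<sigma>\<close>.\<close>
        case 1
        then show ?thesis
          using ff[OF cube_zero_in 2(1)] f0 \<sigma>(2)[OF 2(1)] xw by simp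
      next
        case (2 j)
        have ij: "i \<noteq> j"
          using 2 \<open>x i \<noteq> 0\<close> bit_neq_iff[of "x i" 0] by (auto simp: w_def flip_apply)
        \<comment> \<open>The 4-cycle \<open>z\<close>, \<open>u\<close>, \<open>x\<close>,
          \<open>w\<close>: clearing coordinate \<open>i\<close> or \<open>j\<close> of
          \<open>x\<close> gives \<open>w\<close> or \<open>u\<close>, and clearing both gives
          \<open>z\<close>. The induction hypothesis covers every corner but
          \<open>x\<close>.\<close>
        define z where "z = flip w j"
        define u where "u = flip z i"
        have zV: "z \<in> ?V" unfolding z_def using flip_in_cube[OF wV 2(1)] .
        have uV: "u \<in> ?V" unfolding u_def using flip_in_cube[OF zV \<open>i < n\<close>] .
        have wz: "w = flip z j" by (simp add: z_def flip_flip)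
        have ux: "u = flip x j" unfolding u_def z_def w_def by (simp add: flip_commute flip_flip)
        have xu: "x = flip u j" by (simp add: ux flip_flip)
        have "x j \<noteq> 0" using 2 ij by (simp add: w_def flip_apply)
        then have "weight n u < weight n x" unfolding ux by (rule weight_flip_less[OF 2(1)])
        moreover have "weight n z < weight n x"
          using weight_flip_less[of j n w, OF 2] wx unfolding z_def by simp
        ultimately have IH: "q (f u) = p u" "q (f z) = p z" "q (f w) = p w"
          using less.hyps uV zV wV wx by blast+
        \<comment> \<open>Since \<open>f x\<close> is adjacent to \<open>f u\<close> and
          \<open>f w\<close>, the vertex \<open>q (f x)\<close> is a common neighbour of
          \<open>p u\<close> and \<open>p w\<close>; \<open>common\<close> lifts it to
          \<open>v\<close>, which can only be \<open>z\<close> or \<open>x\<close>.\<close>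
        have "adj H (p u) (q (f x))" "adj H (p w) (q (f x))"
          using fadj[OF uV 2(1)] fadj[OF wV \<open>i < n\<close>] IH xu xw by auto
        then obtain v where v: "adj (cube n) u v" "adj (cube n) w v" "p v = q (f x)"
          using common[of z u w] adj_cube_flip[OF zV] \<open>i < n\<close> \<open>j < n\<close> u_def wz by blast
        then obtain a b' where "v = flip (flip z i) a" "v = flip (flip z j) b'"
          using adj_cube_iff uV wV u_def wz by blast
        then have "v = z \<or> v = x"
          using flip_common[OF ij] xu u_def by metis
        \<comment> \<open>Otherwise \<open>f x\<close> and \<open>f z\<close> would be neighbours of
          \<open>f u\<close> with the same image under \<open>q\<close>, hence equal, although
          \<open>z\<close> has smaller weight than \<open>x\<close>.\<close>
        moreover have "v \<noteq> z"
        proof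
          assume "v = z"
          then have "q (f x) = q (f z)" using v IH by simp
          moreover have "adj (cube n) u z" "adj (cube n) u x"
            using adj_cube_flip[OF uV \<open>i < n\<close>] adj_cube_flip[OF uV \<open>j < n\<close>] xu
            by (simp_all add: u_def flip_flip)
          then have "adj (cube n) (f u) (f z)" "adj (cube n) (f u) (f x)"
            using Aut_adj[OF cube_aut_in_Aut[OF b]] uV zV x unfolding f_def by blast+
          ultimately have "f x = f z" using graph_cover_inj[OF q fV[OF uV]] by blast
          then have "x = z" using cube_aut_inj[OF b x zV] unfolding f_def by blast
          then show False
            using weight_flip_less[of j n w, OF 2] wx unfolding z_def by simp
        qed
        ultimately show ?thesis using v by simp
      qed
    qed
  qed
  then show ?thesis using cube_aut_in_Aut[OF b] unfolding f_def by blast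
qed

section \<open>Conjugates, normalizers and their effect on orbits\<close>

lemma (in group) conjugate_swap:
  assumes "H \<subseteq> carrier G" "g \<in> carrier G" "H' = inv g <# (H #> g)"
  shows "H = g <# (H' #> inv g)"
proof -
  have "H' \<subseteq> carrier G"
    using assms by (simp add: l_coset_subset_G r_coset_subset_G)
  have "H' #> inv g = inv g <# H"
    using assms by (simp add: coset_assoc[symmetric] coset_mult_assoc r_coset_subset_G)
  then show ?thesis using assms by (simp add: lcos_m_assoc lcos_mult_one)
qed

text \<open>\<open>normalizer\<close> is the stabilizer under conjugation with \<open>g\<close> on
  the left and \<open>inv g\<close> on the right, whereas right actions call for the opposite order.
  A set fixed by one of these conjugations is fixed by the other, its inverse.\<close>

lemma (in group) mem_normalizer_iff:
  assumes "H \<subseteq> carrier G"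
  shows "g \<in> normalizer G H \<longleftrightarrow> g \<in> carrier G \<and> H = inv g <# (H #> g)"
proof -
  have "g <# H #> inv g = H \<longleftrightarrow> H = inv g <# (H #> g)" if g: "g \<in> carrier G"
    using conjugate_swap[OF assms g, of H] conjugate_swap[OF assms inv_closed[OF g], of H]
      coset_assoc[OF g inv_closed[OF g] assms] g by auto
  then show ?thesis using assms by (auto simp: normalizer_def stabilizer_def)
qed

lemma (in group) subgroup_conjugate:
  assumes "subgroup H G" "g \<in> carrier G" shows "subgroup (inv g <# (H #> g)) G"
  using subgroup_conjugation_is_surj1[OF assms(2,1)] assms
  by (simp add: coset_assoc subgroup.subset)

text \<open>Products are read from left to right: \<open>inv g\<close>, then \<open>k\<close>, then
  \<open>g\<close> take \<open>g x\<close> to \<open>x\<close>, to \<open>k x\<close> and to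
  \<open>g (k x)\<close>.\<close>

lemma orbit_of_conjugate:
  assumes K: "subgroup K (Aut G)" and g: "g \<in> carrier (Aut G)" and x: "x \<in> verts G"
  shows "orbit_of (inv\<^bsub>Aut G\<^esub> g <#\<^bsub>Aut G\<^esub> (K #>\<^bsub>Aut G\<^esub> g)) (g x) = g ` orbit_of K x"
proof -
  have "(inv\<^bsub>Aut G\<^esub> g \<otimes>\<^bsub>Aut G\<^esub> (k \<otimes>\<^bsub>Aut G\<^esub> g)) (g x) = g (k x)" if "k \<in> K" for k
    using that x g by (simp add: Aut_mult_apply Aut_closed Aut_inv_closed Aut_inv_apply)
  then have "(\<lambda>k. (inv\<^bsub>Aut G\<^esub> g \<otimes>\<^bsub>Aut G\<^esub> (k \<otimes>\<^bsub>Aut G\<^esub> g)) (g x)) ` K = g ` (\<lambda>k. k x) ` K"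
    by (simp add: image_image)
  moreover have "orbit_of (inv\<^bsub>Aut G\<^esub> g <#\<^bsub>Aut G\<^esub> (K #>\<^bsub>Aut G\<^esub> g)) (g x) =
      (\<lambda>k. (inv\<^bsub>Aut G\<^esub> g \<otimes>\<^bsub>Aut G\<^esub> (k \<otimes>\<^bsub>Aut G\<^esub> g)) (g x)) ` K"
    by (auto simp: orbit_of_def l_coset_def r_coset_def)
  moreover have "orbit_of K x = (\<lambda>k. k x) ` K" by (auto simp: orbit_of_def)
  ultimately show ?thesis by simp
qed

text \<open>Serves twice: for conjugate groups it gives the isomorphism of their quotients, and for
  \<open>L = K\<close> it lets the normalizer act on the quotient.\<close>

lemma graph_iso_image:
  assumes K: "subgroup K (Aut G)" and L: "subgroup L (Aut G)" and g: "g \<in> carrier (Aut G)"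
    and s: "simple_graph G"
    and eq: "\<And>x. x \<in> verts G \<Longrightarrow> orbit_of L (g x) = g ` orbit_of K x"
  shows "is_graph_iso (normal_quotient G K) (normal_quotient G L) ((`) g)"
proof -
  have inj: "inj_on g (verts G)" using g by (simp add: mem_carrier_Aut Bij_def bij_betw_def)
  have sub: "X \<subseteq> verts G" if "X \<in> orbit_of K ` verts G" for X
    using that orbit_of_subset[OF K] by blast
  have im: "(`) g ` (orbit_of K ` verts G) = orbit_of L ` verts G"
  proof -
    have "(`) g ` (orbit_of K ` verts G) = orbit_of L ` (g ` verts G)"
      unfolding image_image using eq by simp
    then show ?thesis by (simp add: Aut_image[OF g])
  qed
  have eqi: "g ` X = g ` Y \<longleftrightarrow> X = Y" if "X \<in> orbit_of K ` verts G" "Y \<in> orbit_of K ` verts G" for X Y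
    using inj_on_image_eq_iff[OF inj] sub that by blast
  have "adj (normal_quotient G K) X Y \<longleftrightarrow> adj (normal_quotient G L) (g ` X) (g ` Y)"
    if XY: "X \<in> orbit_of K ` verts G" "Y \<in> orbit_of K ` verts G" for X Y
  proof -
    have "g ` X \<in> orbit_of L ` verts G" "g ` Y \<in> orbit_of L ` verts G" using im XY by blast+
    moreover have "adj G (g x) (g y) \<longleftrightarrow> adj G x y" if "x \<in> X" "y \<in> Y" for x y
      using that sub XY Aut_adj[OF g] by blast
    ultimately show ?thesis using XY eqi[OF XY] by (simp add: normal_quotient_def)
  qed
  moreover have "inj_on ((`) g) (orbit_of K ` verts G)" using eqi by (simp add: inj_on_def)
  ultimately show ?thesis
    using im by (simp add: is_graph_iso_def bij_betw_def normal_quotient_def)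
qed

section \<open>Isomorphisms between normal quotients of the cube\<close>

context
  fixes n :: nat and K L :: "((nat \<Rightarrow> bit) \<Rightarrow> (nat \<Rightarrow> bit)) set"
  assumes K: "subgroup K (Aut (cube n))" and L: "subgroup L (Aut (cube n))"
    and d: "min_displacement (cube n) K \<ge> 5"
begin

lemmas simple_quotient = simple_graph_normal_quotient[OF simple_graph_cube]

text \<open>Every orbit of \<open>L\<close> is a value of the covering
  \<open>\<phi> \<circ> orbit_of K\<close> and so has \<open>n\<close> neighbours, as many as a
  vertex of the cube. This count makes the orbit map of \<open>L\<close> a covering too.\<close>

lemma quotient_iso_cover:
  assumes i: "is_graph_iso (normal_quotient (cube n) K) (normal_quotient (cube n) L) \<phi>"
  shows "graph_cover (cube n) (normal_quotient (cube n) L) (\<phi> \<circ> orbit_of K)"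
    and "graph_cover (cube n) (normal_quotient (cube n) L) (orbit_of L)"
proof -
  let ?p = "\<phi> \<circ> orbit_of K" and ?H = "normal_quotient (cube n) L"
  show p: "graph_cover (cube n) ?H ?p"
    by (rule graph_cover_iso[OF min_displacement_cover[OF K d simple_graph_cube] i
          simple_quotient simple_quotient])
  show "graph_cover (cube n) ?H (orbit_of L)"
  proof (rule regular_quotient_cover[OF L simple_graph_cube finite_cube_neighbours])
    fix x assume x: "x \<in> verts (cube n)"
    then have "orbit_of L x \<in> verts ?H" by (simp add: normal_quotient_def)
    also have "verts ?H = ?p ` verts (cube n)" using p by (simp add: graph_cover_def)
    finally obtain y where y: "y \<in> verts (cube n)" "orbit_of L x = ?p y" by blast
    then have "bij_betw ?p {z. adj (cube n) y z} {Y. adj ?H (orbit_of L x) Y}"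
      using p unfolding graph_cover_def by metis
    then have "card {z. adj (cube n) y z} = card {Y. adj ?H (orbit_of L x) Y}"
      by (rule bij_betw_same_card)
    then show "card {Y. adj ?H (orbit_of L x) Y} = card {z. adj (cube n) x z}"
      by (simp add: card_cube_neighbours x y(1))
  qed
qed

text \<open>Transported along \<open>\<phi>\<close>, \<open>common_neighbour_lift\<close> becomes
  the 4-cycle condition that \<open>cube_lift\<close> asks of
  \<open>\<phi> \<circ> orbit_of K\<close>.\<close>

lemma quotient_iso_lift:
  assumes i: "is_graph_iso (normal_quotient (cube n) K) (normal_quotient (cube n) L) \<phi>"
  shows "\<exists>f\<in>carrier (Aut (cube n)). \<forall>x\<in>verts (cube n). orbit_of L (f x) = \<phi> (orbit_of K x)"
proof -
  let ?K = "normal_quotient (cube n) K" and ?L = "normal_quotient (cube n) L"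
  have "\<exists>c. adj (cube n) u c \<and> adj (cube n) w c \<and> (\<phi> \<circ> orbit_of K) c = C"
    if a: "adj (cube n) z u" "adj (cube n) z w"
      and C: "adj ?L ((\<phi> \<circ> orbit_of K) u) C" "adj ?L ((\<phi> \<circ> orbit_of K) w) C" for z u w C
  proof -
    have "C \<in> verts ?L" using C simple_quotient unfolding simple_graph_def by blast
    then obtain D where D: "D \<in> verts ?K" "C = \<phi> D"
      using i unfolding is_graph_iso_def bij_betw_def by blast
    have "u \<in> verts (cube n)" "w \<in> verts (cube n)"
      using a simple_graph_cube unfolding simple_graph_def by blast+
    then have "orbit_of K u \<in> verts ?K" "orbit_of K w \<in> verts ?K"
      by (simp_all add: normal_quotient_def)
    then have "adj ?K (orbit_of K u) D" "adj ?K (orbit_of K w) D"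
      using i C D unfolding is_graph_iso_def comp_apply by blast+
    then show ?thesis
      using common_neighbour_lift[OF K d simple_graph_cube a] D(2) by auto
  qed
  then show ?thesis
    using cube_lift[OF quotient_iso_cover[OF i]] by simp
qed

text \<open>Because \<open>\<phi>\<close> is injective on orbits, \<open>f z\<close> lies in the
  \<open>L\<close>-orbit of \<open>f x\<close> exactly when \<open>z\<close> lies in the
  \<open>K\<close>-orbit of \<open>x\<close>. So the conjugate of \<open>K\<close> by
  \<open>f\<close> has the orbits of \<open>L\<close>, and \<open>eq_if_orbits_eq\<close> turns this
  into equality of groups.\<close>

lemma lift_conjugates:
  assumes i: "is_graph_iso (normal_quotient (cube n) K) (normal_quotient (cube n) L) \<phi>"
    and f: "f \<in> carrier (Aut (cube n))"
    and lift: "\<And>x. x \<in> verts (cube n) \<Longrightarrow> orbit_of L (f x) = \<phi> (orbit_of K x)"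
  shows "L = inv\<^bsub>Aut (cube n)\<^esub> f <#\<^bsub>Aut (cube n)\<^esub> (K #>\<^bsub>Aut (cube n)\<^esub> f)" (is "L = ?M")
proof -
  let ?V = "verts (cube n)"
  have M: "subgroup ?M (Aut (cube n))"
    by (rule group.subgroup_conjugate[OF group_Aut K f])
  have "orbit_of ?M y = orbit_of L y" if "y \<in> ?V" for y
  proof -
    have "y \<in> f ` ?V" using that by (simp add: Aut_image[OF f])
    then obtain x where x: "x \<in> ?V" "y = f x" by blast
    have "f z \<in> orbit_of L (f x) \<longleftrightarrow> z \<in> orbit_of K x" if z: "z \<in> ?V" for z
    proof -
      have "f z \<in> orbit_of L (f x) \<longleftrightarrow> orbit_of L (f x) = orbit_of L (f z)"
        using orbit_of_eq_iff[OF L Aut_closed[OF f x(1)] Aut_closed[OF f z]] by simp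
      also have "\<dots> \<longleftrightarrow> \<phi> (orbit_of K x) = \<phi> (orbit_of K z)" using lift x z by simp
      also have "\<dots> \<longleftrightarrow> orbit_of K x = orbit_of K z"
        using i x z unfolding is_graph_iso_def bij_betw_def
        by (intro inj_on_eq_iff) (auto simp: normal_quotient_def)
      also have "\<dots> \<longleftrightarrow> z \<in> orbit_of K x" by (rule orbit_of_eq_iff[OF K x(1) z])
      finally show ?thesis .
    qed
    note mem = this
    have "orbit_of L (f x) = f ` orbit_of K x"
    proof (intro equalityI subsetI)
      fix w assume w: "w \<in> orbit_of L (f x)"
      then have "w \<in> ?V" using orbit_of_subset[OF L Aut_closed[OF f x(1)]] by blast
      then have "w \<in> f ` ?V" by (simp add: Aut_image[OF f])
      then obtain z where "z \<in> ?V" "w = f z" by blast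
      then show "w \<in> f ` orbit_of K x" using mem w by blast
    next
      fix w assume "w \<in> f ` orbit_of K x"
      then show "w \<in> orbit_of L (f x)" using mem orbit_of_subset[OF K x(1)] by blast
    qed
    then show ?thesis using orbit_of_conjugate[OF K f x(1)] x(2) by simp
  qed
  then show ?thesis
    using eq_if_orbits_eq[OF simple_graph_cube cube_connected cube_zero_in M L
        quotient_iso_cover(2)[OF i]] by simp
qed

lemma quotient_isomorphic_iff_conjugate:
  "graph_isomorphic (normal_quotient (cube n) K) (normal_quotient (cube n) L) \<longleftrightarrow>
    conjugate_in (Aut (cube n)) K L"
proof
  assume "graph_isomorphic (normal_quotient (cube n) K) (normal_quotient (cube n) L)"
  then show "conjugate_in (Aut (cube n)) K L"
    unfolding graph_isomorphic_def conjugate_in_def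
    using quotient_iso_lift lift_conjugates by metis
next
  assume "conjugate_in (Aut (cube n)) K L"
  then obtain g where g: "g \<in> carrier (Aut (cube n))"
    "L = inv\<^bsub>Aut (cube n)\<^esub> g <#\<^bsub>Aut (cube n)\<^esub> (K #>\<^bsub>Aut (cube n)\<^esub> g)"
    unfolding conjugate_in_def by blast
  then show "graph_isomorphic (normal_quotient (cube n) K) (normal_quotient (cube n) L)"
    unfolding graph_isomorphic_def
    using graph_iso_image[OF K L g(1) simple_graph_cube] orbit_of_conjugate[OF K g(1)] by blast
qed

end

section \<open>The normalizer acting on the quotient\<close>

text \<open>Restricted to the orbits so as to be extensional. For \<open>g\<close> in the
  normalizer, the image of the orbit of \<open>x\<close> is the orbit of \<open>g x\<close>.\<close>

definition quotient_action :: "'a graph_rec \<Rightarrow> ('a \<Rightarrow> 'a) set \<Rightarrow> ('a \<Rightarrow> 'a) \<Rightarrow> 'a set \<Rightarrow> 'a set" where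
  "quotient_action G K g = (\<lambda>X\<in>orbit_of K ` verts G. g ` X)"

context
  fixes G :: "'a graph_rec" and K :: "('a \<Rightarrow> 'a) set"
  assumes K: "subgroup K (Aut G)" and s: "simple_graph G"
begin

lemma normalizer_orbit:
  assumes "g \<in> normalizer (Aut G) K" "x \<in> verts G"
  shows "orbit_of K (g x) = g ` orbit_of K x"
  using assms orbit_of_conjugate[OF K, of g x]
    group.mem_normalizer_iff[OF group_Aut subgroup.subset[OF K]] by metis

lemma normalizer_Aut: "g \<in> normalizer (Aut G) K \<Longrightarrow> g \<in> carrier (Aut G)"
  using group.mem_normalizer_iff[OF group_Aut subgroup.subset[OF K]] by blast

lemma quotient_action_apply:
  assumes "g \<in> normalizer (Aut G) K" "x \<in> verts G"
  shows "quotient_action G K g (orbit_of K x) = orbit_of K (g x)"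
  using normalizer_orbit[OF assms] assms by (simp add: quotient_action_def)

lemma quotient_action_in_Aut:
  assumes g: "g \<in> normalizer (Aut G) K"
  shows "quotient_action G K g \<in> carrier (Aut (normal_quotient G K))"
proof -
  have i: "is_graph_iso (normal_quotient G K) (normal_quotient G K) ((`) g)"
    by (rule graph_iso_image[OF K K normalizer_Aut[OF g] s normalizer_orbit[OF g]])
  have "verts (normal_quotient G K) = orbit_of K ` verts G" by (simp add: normal_quotient_def)
  then show ?thesis
    using i unfolding mem_carrier_Aut is_graph_iso_def Bij_def quotient_action_def
    by (simp add: bij_betw_def inj_on_def)
qed

lemma Aut_quotient_eqI:
  assumes "\<phi> \<in> carrier (Aut (normal_quotient G K))" "\<psi> \<in> carrier (Aut (normal_quotient G K))"
    and "\<And>x. x \<in> verts G \<Longrightarrow> \<phi> (orbit_of K x) = \<psi> (orbit_of K x)"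
  shows "\<phi> = \<psi>"
  by (rule Aut_eqI[OF assms(1,2)]) (use assms(3) in \<open>auto simp: normal_quotient_def\<close>)

lemma quotient_action_group_hom:
  "group_hom ((Aut G)\<lparr>carrier := normalizer (Aut G) K\<rparr>) (Aut (normal_quotient G K))
    (quotient_action G K)"
proof -
  interpret A: group "Aut G" by (rule group_Aut)
  interpret Q: group "Aut (normal_quotient G K)" by (rule group_Aut)
  have N: "subgroup (normalizer (Aut G) K) (Aut G)"
    by (rule A.normalizer_imp_subgroup[OF subgroup.subset[OF K]])
  have "quotient_action G K (g \<otimes>\<^bsub>Aut G\<^esub> h) =
      quotient_action G K g \<otimes>\<^bsub>Aut (normal_quotient G K)\<^esub> quotient_action G K h"
    if gh: "g \<in> normalizer (Aut G) K" "h \<in> normalizer (Aut G) K" for g h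
  proof (rule Aut_quotient_eqI)
    have ghN: "g \<otimes>\<^bsub>Aut G\<^esub> h \<in> normalizer (Aut G) K" using gh subgroup.m_closed[OF N] by blast
    show "quotient_action G K (g \<otimes>\<^bsub>Aut G\<^esub> h) \<in> carrier (Aut (normal_quotient G K))"
      by (rule quotient_action_in_Aut[OF ghN])
    show "quotient_action G K g \<otimes>\<^bsub>Aut (normal_quotient G K)\<^esub> quotient_action G K h
        \<in> carrier (Aut (normal_quotient G K))"
      using gh quotient_action_in_Aut by blast
    fix x assume x: "x \<in> verts G"
    then have "orbit_of K x \<in> verts (normal_quotient G K)" by (simp add: normal_quotient_def)
    then show "quotient_action G K (g \<otimes>\<^bsub>Aut G\<^esub> h) (orbit_of K x) =
        (quotient_action G K g \<otimes>\<^bsub>Aut (normal_quotient G K)\<^esub> quotient_action G K h) (orbit_of K x)"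
      using x gh ghN Aut_closed[OF normalizer_Aut[OF gh(1)] x]
      by (simp add: Aut_mult_apply quotient_action_apply)
  qed
  then show ?thesis
    using A.subgroup_imp_group[OF N] Q.group_axioms quotient_action_in_Aut
    by (simp add: group_hom_def group_hom_axioms_def hom_def)
qed

lemma subgroup_subset_normalizer: "K \<subseteq> normalizer (Aut G) K"
proof -
  interpret A: group "Aut G" by (rule group_Aut)
  interpret K: normal K "(Aut G)\<lparr>carrier := normalizer (Aut G) K\<rparr>"
    by (rule A.subgroup_in_normalizer[OF K])
  show ?thesis using K.subset by simp
qed

text \<open>An element of the kernel moves every vertex within its \<open>K\<close>-orbit, so
  \<open>subset_if_orbits_subset\<close>, applied to the singleton of that element, puts it into
  \<open>K\<close>.\<close>

lemma kernel_quotient_action: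
  assumes x: "x \<in> verts G" and con: "\<And>y. y \<in> verts G \<Longrightarrow> (adj G)\<^sup>*\<^sup>* x y"
    and c: "graph_cover G H (orbit_of K)"
  shows "kernel ((Aut G)\<lparr>carrier := normalizer (Aut G) K\<rparr>) (Aut (normal_quotient G K))
    (quotient_action G K) = K"
proof -
  let ?Q = "Aut (normal_quotient G K)"
  interpret Q: group ?Q by (rule group_Aut)
  have one: "\<one>\<^bsub>?Q\<^esub> (orbit_of K y) = orbit_of K y" if "y \<in> verts G" for y
    using that by (intro Aut_one_apply) (simp add: normal_quotient_def)
  have "quotient_action G K g = \<one>\<^bsub>?Q\<^esub> \<longleftrightarrow> g \<in> K" if g: "g \<in> normalizer (Aut G) K" for g
  proof
    assume e: "quotient_action G K g = \<one>\<^bsub>?Q\<^esub>"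
    have "orbit_of {g} y \<subseteq> orbit_of K y" if y: "y \<in> verts G" for y
    proof -
      have "orbit_of K (g y) = orbit_of K y"
        using quotient_action_apply[OF g y] e one[OF y] by simp
      then have "g y \<in> orbit_of K y"
        using orbit_of_refl[OF K Aut_closed[OF normalizer_Aut[OF g] y]] by simp
      then show ?thesis by (simp add: orbit_of_def)
    qed
    then have "{g} \<subseteq> K"
      using normalizer_Aut[OF g] by (intro subset_if_orbits_subset[OF s con x _ K c]) auto
    then show "g \<in> K" by simp
  next
    assume "g \<in> K"
    then show "quotient_action G K g = \<one>\<^bsub>?Q\<^esub>"
      using quotient_action_apply[OF g] orbit_of_apply[OF K] one
      by (intro Aut_quotient_eqI quotient_action_in_Aut[OF g]) auto
  qed
  then show ?thesis using subgroup_subset_normalizer by (auto simp: kernel_def)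
qed

text \<open>The first isomorphism theorem describes the induced map through \<open>the_elem\<close>
  of the image of a coset. Factors from \<open>K\<close> leave every orbit unchanged, so that image
  has one member.\<close>

lemma the_elem_quotient_action:
  assumes g: "g \<in> normalizer (Aut G) K"
  shows "the_elem (quotient_action G K ` (K #>\<^bsub>Aut G\<^esub> g)) = quotient_action G K g"
proof (rule the_elem_image_unique)
  interpret A: group "Aut G" by (rule group_Aut)
  have N: "subgroup (normalizer (Aut G) K) (Aut G)"
    by (rule A.normalizer_imp_subgroup[OF subgroup.subset[OF K]])
  show "K #>\<^bsub>Aut G\<^esub> g \<noteq> {}" using subgroup.one_closed[OF K] by (auto simp: r_coset_def)
  fix h assume "h \<in> K #>\<^bsub>Aut G\<^esub> g"
  then obtain k where k: "k \<in> K" "h = k \<otimes>\<^bsub>Aut G\<^esub> g" by (auto simp: r_coset_def)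
  have h: "h \<in> normalizer (Aut G) K"
    using k g subgroup_subset_normalizer subgroup.m_closed[OF N] by blast
  show "quotient_action G K h = quotient_action G K g"
  proof (rule Aut_quotient_eqI[OF quotient_action_in_Aut[OF h] quotient_action_in_Aut[OF g]])
    fix x assume x: "x \<in> verts G"
    have kx: "k x \<in> verts G" using Aut_closed[OF subgroup_Aut_mem[OF K k(1)] x] .
    have "quotient_action G K h (orbit_of K x) = quotient_action G K g (orbit_of K (k x))"
      using quotient_action_apply[OF h x] quotient_action_apply[OF g kx] k(2) x
      by (simp add: Aut_mult_apply)
    then show "quotient_action G K h (orbit_of K x) = quotient_action G K g (orbit_of K x)"
      by (simp add: orbit_of_apply[OF K x k(1)])
  qed
qed

end

section \<open>Automorphisms of the quotient as the normalizer modulo \<open>K\<close>\<close>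

text \<open>The case \<open>L = K\<close> of \<open>quotient_iso_lift\<close> and
  \<open>lift_conjugates\<close>: a lift of \<open>\<phi>\<close> conjugates \<open>K\<close> to
  itself and hence lies in the normalizer.\<close>

lemma quotient_action_surj:
  assumes K: "subgroup K (Aut (cube n))" and d: "min_displacement (cube n) K \<ge> 5"
  shows "quotient_action (cube n) K ` normalizer (Aut (cube n)) K =
    carrier (Aut (normal_quotient (cube n) K))"
proof (intro equalityI subsetI)
  fix \<phi> assume phi: "\<phi> \<in> carrier (Aut (normal_quotient (cube n) K))"
  then have i: "is_graph_iso (normal_quotient (cube n) K) (normal_quotient (cube n) K) \<phi>"
    by (simp add: Aut_def)
  obtain f where f: "f \<in> carrier (Aut (cube n))"
      "\<And>x. x \<in> verts (cube n) \<Longrightarrow> orbit_of K (f x) = \<phi> (orbit_of K x)"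
    using quotient_iso_lift[OF K K d i] by blast
  then have N: "f \<in> normalizer (Aut (cube n)) K"
    using lift_conjugates[OF K K d i f]
      group.mem_normalizer_iff[OF group_Aut subgroup.subset[OF K]] by blast
  have "\<phi> = quotient_action (cube n) K f"
    using quotient_action_apply[OF K simple_graph_cube N] f(2)
    by (intro Aut_quotient_eqI[OF K simple_graph_cube phi quotient_action_in_Aut[OF K simple_graph_cube N]]) simp
  then show "\<phi> \<in> quotient_action (cube n) K ` normalizer (Aut (cube n)) K" using N by blast
qed (use quotient_action_in_Aut[OF K simple_graph_cube] in blast)

theorem theorem1p4:
  fixes n :: nat and K L :: "((nat \<Rightarrow> bit) \<Rightarrow> (nat \<Rightarrow> bit)) set"
  assumes "subgroup K (Aut (cube n))"
    and "subgroup L (Aut (cube n))"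
    and "min_displacement (cube n) K \<ge> 5"
  shows "(graph_isomorphic (normal_quotient (cube n) K) (normal_quotient (cube n) L)
            \<longleftrightarrow> conjugate_in (Aut (cube n)) K L)
       \<and> (\<exists>\<Phi> \<in> iso ((Aut (cube n))\<lparr>carrier := normalizer (Aut (cube n)) K\<rparr> Mod K)
                     (Aut (normal_quotient (cube n) K)).
            \<forall>g \<in> normalizer (Aut (cube n)) K. \<forall>x \<in> verts (cube n).
              \<Phi> (K #>\<^bsub>Aut (cube n)\<^esub> g) (orbit_of K x) = orbit_of K (g x))"
proof
  show "graph_isomorphic (normal_quotient (cube n) K) (normal_quotient (cube n) L)
      \<longleftrightarrow> conjugate_in (Aut (cube n)) K L"
    by (rule quotient_isomorphic_iff_conjugate[OF assms])
  let ?h = "quotient_action (cube n) K"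
  interpret group_hom "(Aut (cube n))\<lparr>carrier := normalizer (Aut (cube n)) K\<rparr>"
    "Aut (normal_quotient (cube n) K)" ?h
    by (rule quotient_action_group_hom[OF assms(1) simple_graph_cube])
  have "kernel ((Aut (cube n))\<lparr>carrier := normalizer (Aut (cube n)) K\<rparr>)
      (Aut (normal_quotient (cube n) K)) ?h = K"
    by (rule kernel_quotient_action[OF assms(1) simple_graph_cube cube_zero_in cube_connected
          min_displacement_cover[OF assms(1,3) simple_graph_cube]])
  \<comment> \<open>First isomorphism theorem for \<open>?h\<close>, whose kernel is
    \<open>K\<close> and whose image is the whole automorphism group.\<close>
  then have iso: "(\<lambda>X. the_elem (?h ` X)) \<in>
      iso ((Aut (cube n))\<lparr>carrier := normalizer (Aut (cube n)) K\<rparr> Mod K)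
        (Aut (normal_quotient (cube n) K))"
    using FactGroup_iso_set quotient_action_surj[OF assms(1,3)] by simp
  have "\<forall>g \<in> normalizer (Aut (cube n)) K. \<forall>x \<in> verts (cube n).
      the_elem (?h ` (K #>\<^bsub>Aut (cube n)\<^esub> g)) (orbit_of K x) = orbit_of K (g x)"
    using the_elem_quotient_action[OF assms(1) simple_graph_cube]
      quotient_action_apply[OF assms(1) simple_graph_cube] by simp
  then show "\<exists>\<Phi> \<in> iso ((Aut (cube n))\<lparr>carrier := normalizer (Aut (cube n)) K\<rparr> Mod K)
                     (Aut (normal_quotient (cube n) K)).
            \<forall>g \<in> normalizer (Aut (cube n)) K. \<forall>x \<in> verts (cube n).
              \<Phi> (K #>\<^bsub>Aut (cube n)\<^esub> g) (orbit_of K x) = orbit_of K (g x)"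
    by (rule bexI[OF _ iso])
qed

end
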